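(* Let $X=(x_{ij})\in\mathbb{R}^{n\times m}$ be a real matrix with no zero column, and let $0<\lambda<\lambda_{\max}:=\sum_{j\le m}\max_{i\le n}|x_{ij}|$. Let $t_{\max}=\max_{j\le m}\|X_j\|_1$ and let $t^*$ be the optimal slack variable. For every $t\in(0,t_{\max})$, with $I(t)$ and $\nu(t)$ as defined in the context, $$\operatorname{sign}\Big(\sum_{j\in I(t)}\nu_j(t)-1\Big)=\operatorname{sign}(t^*-t).$$
   Context: $X_j$ denotes the $j$-th column of $X$, $\|\cdot\|_1$ is the $\ell_1$ norm on $\mathbb{R}^n$, $\|\cdot\|_F$ the Frobenius norm, $[a]^+=\max(a,0)$, and $\operatorname{sign}(a)\in\{-1,0,1\}$ with $\operatorname{sign}(0)=0$. The proximal operator of $\lambda\ell_{1,1}$ at $X$ is the unique minimizer $U^*$ over $U\in\mathbb{R}^{n\times m}$ of $\max_{j\le m}\|U_j\|_1+\frac{1}{2\lambda}\|U-X\|_F^2$. Equivalently, $(U^*,t^* )$ is the unique minimizer of $t+\frac{1}{2\lambda}\|U-X\|_F^2$ over $U\in\mathbb{R}^{n\times m}$, $t\ge 0$ subject to $\|U_j\|_1\le t$ for all $j\le m$. The number $t^*$ is called the optimal slack variable. For $t\in[0,t_{\max}]$, define $I(t)=\{j\le m:\ \|X_j\|_1>t\}$. For $t\in(0,t_{\max})$ and $j\le m$ define $\nu_j(t)=0$ if $j\notin I(t)$, and, if $j\in I(t)$, let $\nu_j(t)$ be the unique $\nu>0$ such that $\sum_{i\le n}[|x_{ij}|-\lambda\nu]^+=t$.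 *)

theory Defs
  imports "HOL-Analysis.Analysis"
begin

text \<open>A real \<open>n \<times> m\<close> matrix is an \<open>X :: real ^ 'm ^ 'n\<close>; its entry \<open>x\<^sub>i\<^sub>j\<close> is \<open>X $ i $ j\<close>.\<close>

definition l1_norm :: "real ^ 'n \<Rightarrow> real"
  where "l1_norm v = (\<Sum>i\<in>UNIV. \<bar>v $ i\<bar>)"

text \<open>The Frobenius norm is the \<^const>\<open>norm\<close> of the type of matrices:\<close>

lemma norm_matrix_eq_Frobenius:
  fixes A :: "real ^ 'm ^ 'n"
  shows "norm A = sqrt (\<Sum>i\<in>UNIV. \<Sum>j\<in>UNIV. (A $ i $ j)\<^sup>2)"
  by (simp add: norm_vec_def L2_set_def sum_nonneg)

definition slack_feasible :: "(real ^ 'm ^ 'n) \<times> real \<Rightarrow> bool"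
  where "slack_feasible = (\<lambda>(U, t). t \<ge> 0 \<and> (\<forall>j. l1_norm (column j U) \<le> t))"

definition slack_objective :: "real \<Rightarrow> real ^ 'm ^ 'n \<Rightarrow> (real ^ 'm ^ 'n) \<times> real \<Rightarrow> real"
  where "slack_objective lam X = (\<lambda>(U, t). t + 1 / (2 * lam) * (norm (U - X))\<^sup>2)"

text \<open>For \<open>lam > 0\<close> the minimizing pair exists and is unique, and its first component is the
  proximal operator of \<open>lam max\<^sub>j \<parallel>U\<^sub>j\<parallel>\<^sub>1\<close> at \<open>X\<close>.\<close>

definition optimal_slack :: "real \<Rightarrow> real ^ 'm ^ 'n \<Rightarrow> real"
  where "optimal_slack lam X =
    snd (THE p. is_arg_min (slack_objective lam X) slack_feasible p)"

definition active_cols :: "real ^ 'm ^ 'n \<Rightarrow> real \<Rightarrow> 'm set"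
  where "active_cols X t = {j. l1_norm (column j X) > t}"

text \<open>For \<open>lam > 0\<close>, \<open>t > 0\<close> and \<open>j\<close> active, the description below determines \<open>\<nu>\<close> uniquely.\<close>

definition col_multiplier :: "real \<Rightarrow> real ^ 'm ^ 'n \<Rightarrow> real \<Rightarrow> 'm \<Rightarrow> real"
  where "col_multiplier lam X t j =
    (if j \<in> active_cols X t
     then (THE \<nu>. \<nu> > 0 \<and> (\<Sum>i\<in>UNIV. max (\<bar>X $ i $ j\<bar> - lam * \<nu>) 0) = t)
     else 0)"

definition lambda_max :: "real ^ 'm ^ 'n \<Rightarrow> real"
  where "lambda_max X = (\<Sum>j\<in>UNIV. MAX i. \<bar>X $ i $ j\<bar>)"

definition t_max :: "real ^ 'm ^ 'n \<Rightarrow> real"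
  where "t_max X = (MAX j. l1_norm (column j X))"

end

theory Submission
  imports Defs
begin

text \<open>
  Why the theorem holds. Constraining every column of \<open>U\<close> to the \<open>\<ell>\<^sub>1\<close> ball of radius \<open>t\<close> and then
  projecting \<open>X\<close> means soft-thresholding each column \<open>X\<^sub>j\<close> at a level \<open>\<tau>\<^sub>j(t)\<close>: this level is \<open>0\<close> if
  \<open>X\<^sub>j\<close> already lies in the ball, and otherwise it is the level that brings the \<open>\<ell>\<^sub>1\<close> norm down to
  exactly \<open>t\<close>. For \<open>t > 0\<close> it equals \<open>lam * \<nu>\<^sub>j(t)\<close>, so the theorem compares \<open>\<Sum>\<^sub>j \<tau>\<^sub>j(t)\<close> with
  \<open>lam\<close>. Write \<open>U(t)\<close> for the thresholded matrix.

  Since \<open>X\<^sub>j - U(t)\<^sub>j\<close> is \<open>\<tau>\<^sub>j(t)\<close> times a subgradient of the \<open>\<ell>\<^sub>1\<close> norm at \<open>U(t)\<^sub>j\<close>, every feasible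
  \<open>(V, s)\<close> satisfies
  \<open>s + \<parallel>V - X\<parallel>\<^sup>2 / (2 lam) \<ge> t + \<parallel>U(t) - X\<parallel>\<^sup>2 / (2 lam)
      + (s - t) (1 - \<Sum>\<^sub>j \<tau>\<^sub>j(t) / lam) + \<parallel>V - U(t)\<parallel>\<^sup>2 / (2 lam)\<close>.
  Hence a radius \<open>t\<^sub>0\<close> with \<open>\<Sum>\<^sub>j \<tau>\<^sub>j(t\<^sub>0) = lam\<close> is the optimal slack, and \<open>(U(t\<^sub>0), t\<^sub>0)\<close> is the only
  minimizer (\<open>optimal_slack_eqI\<close>).

  Such a \<open>t\<^sub>0\<close> exists, because each \<open>\<tau>\<^sub>j\<close> is nonincreasing and \<open>1\<close>-Lipschitz in \<open>t\<close>
  (\<open>shrink_threshold_antimono_lipschitz\<close>), and \<open>\<Sum>\<^sub>j \<tau>\<^sub>j\<close> falls from \<open>lambda_max X > lam\<close> at \<open>t = 0\<close> to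
  \<open>0 < lam\<close> at \<open>t = t_max X\<close>. Monotonicity then gives the sign at every other \<open>t\<close>: a sum above
  \<open>lam\<close> forces \<open>t < t\<^sub>0\<close> and a sum below \<open>lam\<close> forces \<open>t > t\<^sub>0\<close>, while a sum equal to \<open>lam\<close> makes
  \<open>t\<close> itself the optimal slack.
\<close>

section \<open>Soft thresholding of a vector\<close>

definition soft :: "real \<Rightarrow> real \<Rightarrow> real"
  where "soft \<tau> x = sgn x * max (\<bar>x\<bar> - \<tau>) 0"

definition shrunk_mass :: "real ^ 'n \<Rightarrow> real \<Rightarrow> real"
  where "shrunk_mass v \<tau> = (\<Sum>i\<in>UNIV. max (\<bar>v $ i\<bar> - \<tau>) 0)"

lemma abs_soft: "0 \<le> \<tau> \<Longrightarrow> \<bar>soft \<tau> x\<bar> = max (\<bar>x\<bar> - \<tau>) 0"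
  by (cases "x = 0") (auto simp: soft_def abs_mult)

text \<open>The scalar form of the statement that the residual \<open>x - soft \<tau> x\<close> is \<open>\<tau>\<close> times a subgradient
  of the absolute value at \<open>soft \<tau> x\<close>.\<close>

lemma soft_residual_subgradient:
  assumes "0 \<le> \<tau>"
  shows "(x - soft \<tau> x) * (y - soft \<tau> x) \<le> \<tau> * (\<bar>y\<bar> - \<bar>soft \<tau> x\<bar>)"
proof (cases "\<bar>x\<bar> \<le> \<tau>")
  case True
  then have "soft \<tau> x = 0"
    by (simp add: soft_def)
  moreover have "x * y \<le> \<tau> * \<bar>y\<bar>"
    using mult_right_mono[OF True abs_ge_zero[of y]] abs_ge_self[of "x * y"] by (simp add: abs_mult)
  ultimately show ?thesis
    by simp
next
  case False
  then have soft: "soft \<tau> x = x - \<tau> * sgn x"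
    by (auto simp: soft_def sgn_if)
  have "sgn x * y \<le> \<bar>y\<bar>"
    by (auto simp: sgn_if)
  moreover have "sgn x * (x - \<tau> * sgn x) = \<bar>soft \<tau> x\<bar>"
    using False assms by (auto simp: soft sgn_if)
  ultimately have "sgn x * (y - soft \<tau> x) \<le> \<bar>y\<bar> - \<bar>soft \<tau> x\<bar>"
    by (simp add: soft right_diff_distrib)
  from mult_left_mono[OF this assms] show ?thesis
    by (simp add: soft mult.assoc)
qed

lemma shrunk_mass_0: "shrunk_mass v 0 = l1_norm v"
  by (simp add: shrunk_mass_def l1_norm_def)

lemma abs_nth_le_Max: "\<bar>(v :: real ^ 'n) $ i\<bar> \<le> (MAX i. \<bar>v $ i\<bar>)"
  by (intro Max_ge) auto

lemma shrunk_mass_eq_0_iff: "shrunk_mass v \<tau> = 0 \<longleftrightarrow> (MAX i. \<bar>v $ i\<bar>) \<le> \<tau>"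
  unfolding shrunk_mass_def by (subst sum_nonneg_eq_0_iff) (auto simp: max_def split: if_splits)

text \<open>Up to the level where nothing is left, the entry of largest modulus alone makes the mass
  decrease at unit rate. This lower bound on the slope is what makes the threshold unique and
  Lipschitz in the target mass.\<close>

lemma shrunk_mass_decrease:
  assumes "a \<le> b" and "b \<le> (MAX i. \<bar>v $ i\<bar>)"
  shows "shrunk_mass v b + (b - a) \<le> shrunk_mass v a"
proof -
  have "(MAX i. \<bar>v $ i\<bar>) \<in> range (\<lambda>i. \<bar>v $ i\<bar>)"
    by (intro Max_in) auto
  then obtain k where k: "(MAX i. \<bar>v $ i\<bar>) = \<bar>v $ k\<bar>"
    by blast
  have "b - a = max (\<bar>v $ k\<bar> - a) 0 - max (\<bar>v $ k\<bar> - b) 0"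
    using assms k by simp
  also have "\<dots> \<le> (\<Sum>i\<in>UNIV. max (\<bar>v $ i\<bar> - a) 0 - max (\<bar>v $ i\<bar> - b) 0)"
    using assms(1) by (intro member_le_sum) auto
  also have "\<dots> = shrunk_mass v a - shrunk_mass v b"
    by (simp add: shrunk_mass_def sum_subtractf)
  finally show ?thesis
    by simp
qed

section \<open>The threshold as a function of the radius\<close>

text \<open>The constraint on the mass and the final disjunction are primal feasibility and complementary
  slackness for the projection onto the \<open>\<ell>\<^sub>1\<close> ball of radius \<open>t\<close>. The upper bound on \<open>\<tau>\<close> matters only at \<open>t = 0\<close>, where any larger threshold would
  give mass \<open>0\<close> as well; with it the threshold is continuous up to \<open>t = 0\<close>.\<close>

definition is_shrink_threshold :: "real ^ 'n \<Rightarrow> real \<Rightarrow> real \<Rightarrow> bool"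
  where "is_shrink_threshold v t \<tau> \<longleftrightarrow>
    0 \<le> \<tau> \<and> \<tau> \<le> (MAX i. \<bar>v $ i\<bar>) \<and> shrunk_mass v \<tau> \<le> t \<and> (\<tau> = 0 \<or> shrunk_mass v \<tau> = t)"

lemma is_shrink_threshold_bounds:
  assumes "is_shrink_threshold v s a" and "is_shrink_threshold v t b" and "s \<le> t"
  shows "b \<le> a" and "a - b \<le> t - s"
proof -
  show "b \<le> a"
  proof (rule ccontr)
    assume "\<not> b \<le> a"
    then show False
      using shrunk_mass_decrease[of a b v] assms unfolding is_shrink_threshold_def by auto
  qed
  then show "a - b \<le> t - s"
    using shrunk_mass_decrease[of b a v] assms unfolding is_shrink_threshold_def by auto
qed

lemma is_shrink_threshold_unique:
  "is_shrink_threshold v t a \<Longrightarrow> is_shrink_threshold v t b \<Longrightarrow> a = b"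
  using is_shrink_threshold_bounds(1)[of v t a t b] is_shrink_threshold_bounds(1)[of v t b t a]
  by simp

lemma is_shrink_threshold_exists:
  assumes "0 \<le> t"
  shows "\<exists>\<tau>. is_shrink_threshold v t \<tau>"
proof -
  let ?M = "MAX i. \<bar>v $ i\<bar>"
  have M: "0 \<le> ?M"
    using abs_nth_le_Max[of v] abs_ge_zero order_trans by blast
  show ?thesis
  proof (cases "shrunk_mass v 0 \<le> t")
    case True
    then have "is_shrink_threshold v t 0"
      using M by (simp add: is_shrink_threshold_def)
    then show ?thesis ..
  next
    case False
    have "shrunk_mass v ?M = 0"
      by (simp add: shrunk_mass_eq_0_iff)
    moreover have "continuous_on {0..?M} (shrunk_mass v)"
      unfolding shrunk_mass_def by (intro continuous_intros)
    ultimately obtain \<tau> where "0 \<le> \<tau>" "\<tau> \<le> ?M" "shrunk_mass v \<tau> = t"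
      using IVT2'[of "shrunk_mass v" ?M t 0] False assms M by auto
    then have "is_shrink_threshold v t \<tau>"
      by (simp add: is_shrink_threshold_def)
    then show ?thesis ..
  qed
qed

definition shrink_threshold :: "real ^ 'n \<Rightarrow> real \<Rightarrow> real"
  where "shrink_threshold v t = (THE \<tau>. is_shrink_threshold v t \<tau>)"

lemma shrink_threshold_eqI: "is_shrink_threshold v t \<tau> \<Longrightarrow> shrink_threshold v t = \<tau>"
  unfolding shrink_threshold_def by (blast intro: is_shrink_threshold_unique)

lemma is_shrink_threshold_shrink_threshold:
  "0 \<le> t \<Longrightarrow> is_shrink_threshold v t (shrink_threshold v t)"
  using is_shrink_threshold_exists shrink_threshold_eqI by metis

lemma shrink_threshold_antimono_lipschitz:
  assumes "0 \<le> s" and "s \<le> t"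
  shows "shrink_threshold v t \<le> shrink_threshold v s"
    and "shrink_threshold v s - shrink_threshold v t \<le> t - s"
  using assms is_shrink_threshold_bounds[of v s "shrink_threshold v s" t "shrink_threshold v t"]
  by (simp_all add: is_shrink_threshold_shrink_threshold)

lemma continuous_on_shrink_threshold: "continuous_on {0..} (shrink_threshold v)"
proof -
  have "\<bar>shrink_threshold v s - shrink_threshold v t\<bar> \<le> \<bar>s - t\<bar>" if "0 \<le> s" "0 \<le> t" for s t
    using that shrink_threshold_antimono_lipschitz[of s t v]
      shrink_threshold_antimono_lipschitz[of t s v]
    by (cases "s \<le> t") auto
  then have "1-lipschitz_on {0..} (shrink_threshold v)"
    by (intro lipschitz_onI) (auto simp: dist_real_def)
  then show ?thesis
    by (rule lipschitz_on_continuous_on)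
qed

lemma shrink_threshold_0: "shrink_threshold v 0 = (MAX i. \<bar>v $ i\<bar>)"
proof (rule shrink_threshold_eqI)
  have "0 \<le> (MAX i. \<bar>v $ i\<bar>)"
    using abs_nth_le_Max[of v] abs_ge_zero order_trans by blast
  moreover have "shrunk_mass v (MAX i. \<bar>v $ i\<bar>) = 0"
    by (simp add: shrunk_mass_eq_0_iff)
  ultimately show "is_shrink_threshold v 0 (MAX i. \<bar>v $ i\<bar>)"
    by (simp add: is_shrink_threshold_def)
qed

lemma shrink_threshold_eq_0:
  assumes "l1_norm v \<le> t"
  shows "shrink_threshold v t = 0"
proof (rule shrink_threshold_eqI)
  have "0 \<le> (MAX i. \<bar>v $ i\<bar>)"
    using abs_nth_le_Max[of v] abs_ge_zero order_trans by blast
  then show "is_shrink_threshold v t 0"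
    using assms by (simp add: is_shrink_threshold_def shrunk_mass_0)
qed

text \<open>For positive radius the bound \<open>\<tau> \<le> (MAX i. \<bar>v $ i\<bar>)\<close> is automatic, since positive mass must
  remain; so the defining equation of the multiplier determines the threshold.\<close>

lemma col_multiplier_eq_shrink_threshold:
  assumes "0 < lam" and "0 < t"
  shows "col_multiplier lam X t j = shrink_threshold (column j X) t / lam"
proof (cases "j \<in> active_cols X t")
  case False
  then show ?thesis
    by (simp add: col_multiplier_def active_cols_def shrink_threshold_eq_0)
next
  case True
  let ?v = "column j X" and ?\<tau> = "shrink_threshold (column j X) t"
  have mass: "(\<Sum>i\<in>UNIV. max (\<bar>X $ i $ j\<bar> - lam * \<nu>) 0) = shrunk_mass ?v (lam * \<nu>)" for \<nu>
    by (simp add: shrunk_mass_def column_def)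
  have \<tau>: "is_shrink_threshold ?v t ?\<tau>"
    using assms by (simp add: is_shrink_threshold_shrink_threshold)
  moreover have "?\<tau> \<noteq> 0"
    using True \<tau> by (auto simp: is_shrink_threshold_def active_cols_def shrunk_mass_0)
  ultimately have pos: "0 < ?\<tau>" and eq: "shrunk_mass ?v ?\<tau> = t"
    by (auto simp: is_shrink_threshold_def)
  have "\<nu> = ?\<tau> / lam" if "0 < \<nu>" "shrunk_mass ?v (lam * \<nu>) = t" for \<nu>
  proof -
    have "lam * \<nu> \<le> (MAX i. \<bar>?v $ i\<bar>)"
      using that assms shrunk_mass_eq_0_iff[of ?v "lam * \<nu>"] by linarith
    then have "is_shrink_threshold ?v t (lam * \<nu>)"
      using that assms by (simp add: is_shrink_threshold_def)
    then show ?thesis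
      using assms by (simp add: shrink_threshold_eqI)
  qed
  then have "(THE \<nu>. 0 < \<nu> \<and> shrunk_mass ?v (lam * \<nu>) = t) = ?\<tau> / lam"
    using pos eq assms by (intro the_equality) auto
  then show ?thesis
    using True by (simp add: col_multiplier_def mass)
qed

section \<open>The optimal slack\<close>

definition shrink_matrix :: "real ^ 'm ^ 'n \<Rightarrow> real \<Rightarrow> real ^ 'm ^ 'n"
  where "shrink_matrix X t = (\<chi> i j. soft (shrink_threshold (column j X) t) (X $ i $ j))"

lemma l1_norm_column_shrink_matrix:
  assumes "0 \<le> t"
  shows "l1_norm (column j (shrink_matrix X t))
    = shrunk_mass (column j X) (shrink_threshold (column j X) t)"
  using is_shrink_threshold_shrink_threshold[OF assms, of "column j X"]
  by (simp add: l1_norm_def shrunk_mass_def column_def shrink_matrix_def abs_soft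
      is_shrink_threshold_def)

lemma inner_matrix_eq_sum_columns:
  fixes A B :: "real ^ 'm ^ 'n"
  shows "A \<bullet> B = (\<Sum>j\<in>UNIV. \<Sum>i\<in>UNIV. A $ i $ j * B $ i $ j)"
  unfolding inner_vec_def inner_real_def by (rule sum.swap)

text \<open>The subgradient inequality summed over all entries. Complementary slackness allows the norm
  of a thresholded column to be replaced by \<open>t\<close>: where that norm is below \<open>t\<close>, its weight
  vanishes.\<close>

lemma shrink_matrix_variational_inequality:
  fixes X V :: "real ^ 'm ^ 'n"
  assumes "0 \<le> t" and V: "\<And>j. l1_norm (column j V) \<le> s"
  shows "(X - shrink_matrix X t) \<bullet> (V - shrink_matrix X t)
    \<le> (\<Sum>j\<in>UNIV. shrink_threshold (column j X) t) * (s - t)"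
proof -
  let ?U = "shrink_matrix X t" and ?\<tau> = "\<lambda>j. shrink_threshold (column j X) t"
  have \<tau>: "is_shrink_threshold (column j X) t (?\<tau> j)" for j
    using assms(1) by (rule is_shrink_threshold_shrink_threshold)
  have "(\<Sum>i\<in>UNIV. (X - ?U) $ i $ j * (V - ?U) $ i $ j) \<le> ?\<tau> j * (s - t)" for j
  proof -
    have \<tau>0: "0 \<le> ?\<tau> j"
      using \<tau>[of j] by (simp add: is_shrink_threshold_def)
    have "(\<Sum>i\<in>UNIV. (X - ?U) $ i $ j * (V - ?U) $ i $ j)
        \<le> (\<Sum>i\<in>UNIV. ?\<tau> j * (\<bar>V $ i $ j\<bar> - \<bar>?U $ i $ j\<bar>))"
      using soft_residual_subgradient[OF \<tau>0] by (intro sum_mono) (simp add: shrink_matrix_def)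
    also have "\<dots> = ?\<tau> j * (l1_norm (column j V) - l1_norm (column j ?U))"
      by (simp add: l1_norm_def column_def sum_distrib_left right_diff_distrib sum_subtractf)
    also have "\<dots> \<le> ?\<tau> j * (s - l1_norm (column j ?U))"
      using \<tau>0 V[of j] by (intro mult_left_mono) auto
    also have "\<dots> = ?\<tau> j * (s - t)"
      using \<tau>[of j] assms(1) by (auto simp: l1_norm_column_shrink_matrix is_shrink_threshold_def)
    finally show ?thesis .
  qed
  then show ?thesis
    unfolding inner_matrix_eq_sum_columns sum_distrib_right by (intro sum_mono) auto
qed

text \<open>When the thresholds add up to \<open>lam\<close>, the linear terms in \<open>s - t\<close> of the objective and of the
  variational inequality cancel, and the remaining quadratic term makes the minimizer unique.\<close>

lemma optimal_slack_eqI: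
  fixes X :: "real ^ 'm ^ 'n"
  assumes "0 < lam" and "0 \<le> t" and sum: "(\<Sum>j\<in>UNIV. shrink_threshold (column j X) t) = lam"
  shows "optimal_slack lam X = t"
proof -
  let ?U = "shrink_matrix X t"
  let ?f = "slack_objective lam X"
  have lower: "?f (?U, t) + 1 / (2 * lam) * (norm (V - ?U))\<^sup>2 \<le> ?f (V, s)"
    if "slack_feasible (V, s)" for V s
  proof -
    have "(norm (V - X))\<^sup>2 = (norm (?U - X))\<^sup>2 + 2 * ((?U - X) \<bullet> (V - ?U)) + (norm (V - ?U))\<^sup>2"
      using dot_norm[of "?U - X" "V - ?U"] by simp
    also have "(?U - X) \<bullet> (V - ?U) = - ((X - ?U) \<bullet> (V - ?U))"
      by (metis inner_minus_left minus_diff_eq)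
    finally have "(norm (V - X))\<^sup>2
        \<ge> (norm (?U - X))\<^sup>2 - 2 * lam * (s - t) + (norm (V - ?U))\<^sup>2"
      using shrink_matrix_variational_inequality[of t V s X] that assms
      by (auto simp: slack_feasible_def)
    then have "((norm (?U - X))\<^sup>2 - 2 * lam * (s - t) + (norm (V - ?U))\<^sup>2) / (2 * lam)
        \<le> (norm (V - X))\<^sup>2 / (2 * lam)"
      using assms(1) by (intro divide_right_mono) auto
    then show ?thesis
      using assms(1) by (simp add: slack_objective_def add_divide_distrib diff_divide_distrib)
  qed
  have feasible: "slack_feasible (?U, t)"
    using assms(2) is_shrink_threshold_shrink_threshold[OF assms(2)]
    by (auto simp: slack_feasible_def l1_norm_column_shrink_matrix is_shrink_threshold_def)
  have "(THE p. is_arg_min ?f slack_feasible p) = (?U, t)"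
  proof (rule the_equality)
    have "?f (?U, t) \<le> ?f p" if "slack_feasible p" for p
    proof -
      have "0 \<le> 1 / (2 * lam) * (norm (fst p - ?U))\<^sup>2"
        using assms(1) by simp
      then show ?thesis
        using lower[of "fst p" "snd p"] that by simp
    qed
    then show "is_arg_min ?f slack_feasible (?U, t)"
      using feasible by (auto simp: is_arg_min_def not_less)
  next
    fix p
    assume p: "is_arg_min ?f slack_feasible p"
    obtain V s where [simp]: "p = (V, s)"
      by (cases p)
    have le: "?f (V, s) \<le> ?f (?U, t)" and "slack_feasible (V, s)"
      using p feasible by (auto simp: is_arg_min_def not_less)
    then have "1 / (2 * lam) * (norm (V - ?U))\<^sup>2 \<le> 0"
      using lower[of V s] by linarith
    then have "V = ?U"
      using assms(1) by (simp add: divide_le_0_iff)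
    moreover from this have "s = t"
      using le lower[of V s] \<open>slack_feasible (V, s)\<close> by (simp add: slack_objective_def)
    ultimately show "p = (?U, t)"
      by simp
  qed
  then show ?thesis
    by (simp add: optimal_slack_def)
qed

theorem proposition3:
  fixes X :: "real ^ 'm ^ 'n" and lam t :: real
  assumes "\<And>j. column j X \<noteq> 0"
    and "0 < lam" and "lam < lambda_max X"
    and "0 < t" and "t < t_max X"
  shows "sgn ((\<Sum>j\<in>active_cols X t. col_multiplier lam X t j) - 1)
       = sgn (optimal_slack lam X - t)"
proof -
  define T where "T r = (\<Sum>j\<in>UNIV. shrink_threshold (column j X) r)" for r
  have T_antimono: "T b \<le> T a" if "0 \<le> a" "a \<le> b" for a b
    unfolding T_def using that by (intro sum_mono shrink_threshold_antimono_lipschitz)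
  have "T 0 = lambda_max X"
    by (simp add: T_def lambda_max_def shrink_threshold_0 column_def)
  moreover have "T (t_max X) = 0"
    unfolding T_def t_max_def by (intro sum.neutral ballI shrink_threshold_eq_0 Max_ge) auto
  moreover have "continuous_on {0..t_max X} T"
    unfolding T_def
    by (intro continuous_intros continuous_on_subset[OF continuous_on_shrink_threshold]) auto
  ultimately obtain r where r: "0 \<le> r" "T r = lam"
    using IVT2'[of T "t_max X" lam 0] assms by auto
  then have slack: "optimal_slack lam X = r"
    using assms(2) by (intro optimal_slack_eqI) (simp_all add: T_def)
  have "(\<Sum>j\<in>active_cols X t. col_multiplier lam X t j)
      = (\<Sum>j\<in>UNIV. col_multiplier lam X t j)"
    by (intro sum.mono_neutral_left) (auto simp: col_multiplier_def)
  also have "\<dots> = T t / lam"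
    using assms by (simp add: T_def col_multiplier_eq_shrink_threshold sum_divide_distrib)
  finally have sum: "(\<Sum>j\<in>active_cols X t. col_multiplier lam X t j) = T t / lam" .
  consider "T t > lam" | "T t < lam" | "T t = lam"
    by linarith
  then show ?thesis
  proof cases
    case 1
    then have "t < r"
      using T_antimono[of r t] r by force
    then show ?thesis
      using 1 assms(2) by (simp add: sum slack)
  next
    case 2
    then have "r < t"
      using T_antimono[of t r] r assms(4) by force
    then show ?thesis
      using 2 assms(2) by (simp add: sum slack)
  next
    case 3
    then have "optimal_slack lam X = t"
      using assms by (intro optimal_slack_eqI) (simp_all add: T_def)
    then show ?thesis
      using 3 assms(2) by (simp add: sum)
  qed
qed

end
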